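(* Let $\mathcal M$ and $\mathcal N=\{N^{(\lambda)}:\lambda\in\mathbb R_{>0}\}$ be two quasianalytic weight matrices and assume $\sup_{k\in\mathbb N_{>0}}(n^{(\lambda)}_k)^{1/k}=+\infty$ for all $\lambda>0$ (Roumieu case) resp. $\lim_{k\to+\infty}(n^{(\lambda)}_k)^{1/k}=+\infty$ for all $\lambda>0$ (Beurling case). Then $\Lambda^r_{[\mathcal N]}\setminus j^\infty(\mathcal E^{0,r}_{\{\mathcal M\}})$ is lineable in $\Lambda^r_{[\mathcal N]}$ (and hence so is $\Lambda^r_{[\mathcal N]}\setminus j^\infty(\mathcal E^{0,r}_{(\mathcal M)})$).
   Context: For a sequence $M=(M_p)_{p\in\mathbb N}$ of positive reals write $m_p:=M_p/p!$. $M$ is a weight sequence if $1=M_0\le M_1$, $M_p^2\le M_{p-1}M_{p+1}$ for all $p\ge1$, and $\liminf_{p\to\infty}m_p^{1/p}>0$; it is quasianalytic if $\sum_{p\ge1}M_{p-1}/M_p=+\infty$. A weight matrix is a family $\mathcal M=\{M^{(\lambda)}:\lambda\in\mathbb R_{>0}\}$ of weight sequences with $M^{(\lambda)}_p\le M^{(\kappa)}_p$ for all $p$ whenever $\lambda\le\kappa$; write $n^{(\lambda)}_p:=N^{(\lambda)}_p/p!$. It is quasianalytic if every member is quasianalytic. For $U\subseteq\mathbb R^r$ open, $K\subseteq U$ compact, $h>0$: $\|f\|^M_{K,h}:=\sup_{\alpha\in\mathbb N^r,x\in K}|\partial^\alpha f(x)|/(h^{|\alpha|}M_{|\alpha|})$.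 $\mathcal E_{\{\mathcal M\}}(U)$: smooth $f$ such that for every compact $K\subseteq U$ there exist $\lambda>0$, $h>0$ with $\|f\|^{M^{(\lambda)}}_{K,h}<\infty$; $\mathcal E_{(\mathcal M)}(U)$: smooth $f$ with $\|f\|^{M^{(\lambda)}}_{K,h}<\infty$ for all compact $K$, all $\lambda>0$, all $h>0$. $\mathcal E^{0,r}_{\{\mathcal M\}}$, $\mathcal E^{0,r}_{(\mathcal M)}$ are the corresponding spaces of germs at $0\in\mathbb R^r$. For $\mathbf b=(b_\alpha)_{\alpha\in\mathbb N^r}$, a weight sequence $N$, $h>0$: $|\mathbf b|^N_h:=\sup_\alpha|b_\alpha|/(h^{|\alpha|}n_{|\alpha|})$; $\Lambda^r_{\{\mathcal N\}}:=\{\mathbf b:\exists\lambda>0\,\exists h>0,\ |\mathbf b|^{N^{(\lambda)}}_h<\infty\}$, $\Lambda^r_{(\mathcal N)}:=\{\mathbf b:\forall\lambda>0\,\forall h>0,\ |\mathbf b|^{N^{(\lambda)}}_h<\infty\}$. The Borel map is $j^\infty(f)=(\partial^\alpha f(0)/|\alpha|!)_{\alpha\in\mathbb N^r}$. $[\cdot]$ means $\{\cdot\}$ throughout or $(\cdot)$ throughout. A subset $L$ of a vector space $X$ is lineable if $L\cup\{0\}$ contains an infinite-dimensional vector subspace. *)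

theory Defs
  imports "HOL-Analysis.Analysis"
begin

text \<open>Multi-indices in N^r are functions 'n => nat on a finite index type 'n (r = CARD('n)).\<close>

definition mlen :: "('n::finite \<Rightarrow> nat) \<Rightarrow> nat" where
  "mlen \<alpha> = (\<Sum>i\<in>UNIV. \<alpha> i)"

definition weight_sequence :: "(nat \<Rightarrow> real) \<Rightarrow> bool" where
  "weight_sequence M \<longleftrightarrow>
     (\<forall>p. M p > 0) \<and> M 0 = 1 \<and> M 0 \<le> M 1 \<and>
     (\<forall>p\<ge>1. (M p)\<^sup>2 \<le> M (p - 1) * M (p + 1)) \<and>
     liminf (\<lambda>p. ereal (root p (M p / fact p))) > 0"

definition quasianalytic :: "(nat \<Rightarrow> real) \<Rightarrow> bool" where
  "quasianalytic M \<longleftrightarrow> \<not> summable (\<lambda>p. M p / M (Suc p))"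

definition weight_matrix :: "(real \<Rightarrow> nat \<Rightarrow> real) \<Rightarrow> bool" where
  "weight_matrix MM \<longleftrightarrow>
     (\<forall>l>0. weight_sequence (MM l)) \<and>
     (\<forall>l k p. 0 < l \<longrightarrow> l \<le> k \<longrightarrow> MM l p \<le> MM k p)"

definition quasianalytic_matrix :: "(real \<Rightarrow> nat \<Rightarrow> real) \<Rightarrow> bool" where
  "quasianalytic_matrix MM \<longleftrightarrow> (\<forall>l>0. quasianalytic (MM l))"

text \<open>Smooth functions on an open set U: a family D of continuous functions with D 0 = f on U
  and D (alpha + e_i) the i-th partial derivative of D alpha on U; thus D alpha is the
  classical partial derivative of f of order alpha.\<close>
definition smooth_family :: "(real^'n) set \<Rightarrow> (('n \<Rightarrow> nat) \<Rightarrow> real^'n \<Rightarrow> real) \<Rightarrow> bool" where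
  "smooth_family U D \<longleftrightarrow>
     (\<forall>\<alpha>. continuous_on U (D \<alpha>)) \<and>
     (\<forall>\<alpha> i x. x \<in> U \<longrightarrow>
        ((\<lambda>t. D \<alpha> (x + t *\<^sub>R axis i 1)) has_real_derivative D (\<alpha>(i := Suc (\<alpha> i))) x) (at 0))"

definition norm_finite :: "(nat \<Rightarrow> real) \<Rightarrow> (real^'n) set \<Rightarrow> real \<Rightarrow> (('n \<Rightarrow> nat) \<Rightarrow> real^'n \<Rightarrow> real) \<Rightarrow> bool" where
  "norm_finite M K h D \<longleftrightarrow>
     (\<exists>C. \<forall>\<alpha>. \<forall>x\<in>K. \<bar>D \<alpha> x\<bar> \<le> C * h ^ mlen \<alpha> * M (mlen \<alpha>))"

definition E_roumieu_family :: "(real \<Rightarrow> nat \<Rightarrow> real) \<Rightarrow> (real^'n) set \<Rightarrow> (('n::finite \<Rightarrow> nat) \<Rightarrow> real^'n \<Rightarrow> real) \<Rightarrow> bool" where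
  "E_roumieu_family MM U D \<longleftrightarrow> smooth_family U D \<and>
     (\<forall>K. compact K \<and> K \<subseteq> U \<longrightarrow> (\<exists>l>0. \<exists>h>0. norm_finite (MM l) K h D))"

definition E_beurling_family :: "(real \<Rightarrow> nat \<Rightarrow> real) \<Rightarrow> (real^'n) set \<Rightarrow> (('n::finite \<Rightarrow> nat) \<Rightarrow> real^'n \<Rightarrow> real) \<Rightarrow> bool" where
  "E_beurling_family MM U D \<longleftrightarrow> smooth_family U D \<and>
     (\<forall>K. compact K \<and> K \<subseteq> U \<longrightarrow> (\<forall>l>0. \<forall>h>0. norm_finite (MM l) K h D))"

definition E_roumieu :: "(real \<Rightarrow> nat \<Rightarrow> real) \<Rightarrow> (real^'n::finite) set \<Rightarrow> (real^'n \<Rightarrow> real) set" where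
  "E_roumieu MM U = {f. \<exists>D. E_roumieu_family MM U D \<and> (\<forall>x\<in>U. D (\<lambda>_. 0) x = f x)}"

definition E_beurling :: "(real \<Rightarrow> nat \<Rightarrow> real) \<Rightarrow> (real^'n::finite) set \<Rightarrow> (real^'n \<Rightarrow> real) set" where
  "E_beurling MM U = {f. \<exists>D. E_beurling_family MM U D \<and> (\<forall>x\<in>U. D (\<lambda>_. 0) x = f x)}"

text \<open>Images j^infty(E^{0,r}_{[M]}) of germs at 0: jets (d^alpha f(0)/|alpha|!) of functions
  of class [M] on some open neighbourhood of 0.\<close>
definition jet_roumieu :: "(real \<Rightarrow> nat \<Rightarrow> real) \<Rightarrow> (('n::finite \<Rightarrow> nat) \<Rightarrow> real) set" where
  "jet_roumieu MM = {b. \<exists>U D. open U \<and> (0::real^'n) \<in> U \<and> E_roumieu_family MM U D \<and>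
       b = (\<lambda>\<alpha>. D \<alpha> 0 / fact (mlen \<alpha>))}"

definition jet_beurling :: "(real \<Rightarrow> nat \<Rightarrow> real) \<Rightarrow> (('n::finite \<Rightarrow> nat) \<Rightarrow> real) set" where
  "jet_beurling MM = {b. \<exists>U D. open U \<and> (0::real^'n) \<in> U \<and> E_beurling_family MM U D \<and>
       b = (\<lambda>\<alpha>. D \<alpha> 0 / fact (mlen \<alpha>))}"

definition seq_norm_finite :: "(nat \<Rightarrow> real) \<Rightarrow> real \<Rightarrow> (('n::finite \<Rightarrow> nat) \<Rightarrow> real) \<Rightarrow> bool" where
  "seq_norm_finite N h b \<longleftrightarrow>
     (\<exists>C. \<forall>\<alpha>. \<bar>b \<alpha>\<bar> \<le> C * h ^ mlen \<alpha> * (N (mlen \<alpha>) / fact (mlen \<alpha>)))"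

definition Lambda_roumieu :: "(real \<Rightarrow> nat \<Rightarrow> real) \<Rightarrow> (('n::finite \<Rightarrow> nat) \<Rightarrow> real) set" where
  "Lambda_roumieu NN = {b. \<exists>l>0. \<exists>h>0. seq_norm_finite (NN l) h b}"

definition Lambda_beurling :: "(real \<Rightarrow> nat \<Rightarrow> real) \<Rightarrow> (('n::finite \<Rightarrow> nat) \<Rightarrow> real) set" where
  "Lambda_beurling NN = {b. \<forall>l>0. \<forall>h>0. seq_norm_finite (NN l) h b}"

text \<open>L is lineable: L \<union> {0} contains an infinite-dimensional real vector subspace of the
  space of real functions on the index set (pointwise operations). Infinite dimension is
  expressed by containing an infinite linearly independent sequence.\<close>
definition fun_subspace :: "('a \<Rightarrow> real) set \<Rightarrow> bool" where
  "fun_subspace V \<longleftrightarrow> (\<lambda>_. 0) \<in> V \<and>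
     (\<forall>u\<in>V. \<forall>w\<in>V. (\<lambda>x. u x + w x) \<in> V) \<and>
     (\<forall>c::real. \<forall>u\<in>V. (\<lambda>x. c * u x) \<in> V)"

definition lin_indep_seq :: "(nat \<Rightarrow> 'a \<Rightarrow> real) \<Rightarrow> bool" where
  "lin_indep_seq v \<longleftrightarrow>
     (\<forall>n c. (\<lambda>x. \<Sum>i<n. c i * v i x) = (\<lambda>_. 0) \<longrightarrow> (\<forall>i<n. c i = (0::real)))"

definition lineable :: "('a \<Rightarrow> real) set \<Rightarrow> bool" where
  "lineable L \<longleftrightarrow> (\<exists>V. fun_subspace V \<and> V \<subseteq> L \<union> {(\<lambda>_. 0)} \<and>
     (\<exists>v. (\<forall>n. v n \<in> V) \<and> lin_indep_seq v))"

end

theory Submission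
  imports Defs "HOL-Computational_Algebra.Polynomial" "HOL-Real_Asymp.Real_Asymp"
begin

text \<open>
  It suffices to look at jets carried by one coordinate axis. There the key fact is a one-sided
  form of Bang's proof of the Denjoy--Carleman theorem: if \<open>f\<close> lies in a quasianalytic class on
  \<open>[0, T]\<close> and all its derivatives at \<open>0\<close> are nonnegative, then they are nonnegative on all of
  \<open>[0, T]\<close>. By Taylor's formula the \<open>j\<close>-th Taylor term of \<open>f\<close> at \<open>T\<close> is then at most \<open>f T\<close>, so
  the jet of \<open>f\<close> grows at most geometrically. Hence a nonnegative sequence \<open>a\<close> that is small
  enough for the sequence space of \<open>N\<close> but grows faster than every geometric sequence is not a
  jet, and neither is \<open>p(k) a\<^sub>k\<close> for a nonzero real polynomial \<open>p\<close>, because \<open>p\<close> is eventually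
  of constant sign and bounded away from zero.
\<close>

section \<open>Comparison of real functions through their derivatives\<close>

lemma le_of_derivative_le:
  fixes f g :: "real \<Rightarrow> real"
  assumes "a \<le> b"
    and f: "\<And>x. x \<in> {a..b} \<Longrightarrow> (f has_real_derivative f' x) (at x within {a..b})"
    and g: "\<And>x. x \<in> {a..b} \<Longrightarrow> (g has_real_derivative g' x) (at x within {a..b})"
    and le_derivative: "\<And>x. x \<in> {a..b} \<Longrightarrow> f' x \<le> g' x"
    and le_start: "f a \<le> g a"
  shows "f b \<le> g b"
proof -
  have diff: "((\<lambda>x. g x - f x) has_real_derivative g' x - f' x) (at x within {a..b})"
    if "x \<in> {a..b}" for x
    using g[OF that] f[OF that] by (rule DERIV_diff)
  have "g a - f a \<le> g b - f b"
  proof (rule DERIV_nonneg_imp_increasing_open[OF \<open>a \<le> b\<close>])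
    fix x assume x: "a < x" "x < b"
    then have "((\<lambda>x. g x - f x) has_real_derivative g' x - f' x) (at x)"
      using diff[of x] at_within_Icc_at[of a x b] by simp
    then show "\<exists>y. ((\<lambda>x. g x - f x) has_real_derivative y) (at x) \<and> 0 \<le> y"
      using le_derivative[of x] x by (intro exI[of _ "g' x - f' x"]) auto
  qed (use diff in \<open>rule DERIV_continuous_on\<close>)
  then show ?thesis using le_start by simp
qed

lemma neg_exp_le_of_derivative_ge:
  fixes f :: "real \<Rightarrow> real"
  assumes "a \<le> b"
    and f: "\<And>x. x \<in> {a..b} \<Longrightarrow> (f has_real_derivative f' x) (at x within {a..b})"
    and "\<And>x. x \<in> {a..b} \<Longrightarrow> - (c * (A * exp (c * (x - a)))) \<le> f' x"
    and "- A \<le> f a"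
  shows "- (A * exp (c * (b - a))) \<le> f b"
proof (rule le_of_derivative_le[OF \<open>a \<le> b\<close> _ f])
  fix x
  show "((\<lambda>x. - (A * exp (c * (x - a)))) has_real_derivative - (c * (A * exp (c * (x - a)))))
      (at x within {a..b})"
    by (auto intro!: derivative_eq_intros)
qed (use assms in auto)

lemma taylor_term_le_of_nonneg_derivatives:
  fixes F :: "nat \<Rightarrow> real \<Rightarrow> real"
  assumes deriv: "\<And>j x. x \<in> {0..T} \<Longrightarrow> (F j has_real_derivative F (Suc j) x) (at x within {0..T})"
    and nonneg: "\<And>j x. x \<in> {0..T} \<Longrightarrow> 0 \<le> F j x"
    and "x \<in> {0..T}"
  shows "F (j + n) 0 / fact n * x ^ n \<le> F j x"
  using \<open>x \<in> {0..T}\<close>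
proof (induction n arbitrary: j x)
  case 0
  have "F j 0 \<le> F j x"
  proof (rule le_of_derivative_le[where a = 0 and f = "\<lambda>_. F j 0" and f' = "\<lambda>_. 0" and g = "F j"])
    fix s assume s: "s \<in> {0..x}"
    show "(F j has_real_derivative F (Suc j) s) (at s within {0..x})"
      using s 0 by (auto intro: DERIV_subset[OF deriv])
    show "0 \<le> F (Suc j) s" using s 0 by (intro nonneg) auto
  qed (use 0 in auto)
  then show ?case by simp
next
  case (Suc n)
  have "F (j + Suc n) 0 / fact (Suc n) * x ^ Suc n \<le> F j x"
  proof (rule le_of_derivative_le[where a = 0 and g = "F j"
        and f = "\<lambda>x. F (j + Suc n) 0 / fact (Suc n) * x ^ Suc n"])
    fix s assume s: "s \<in> {0..x}"
    have "((\<lambda>x. F (j + Suc n) 0 / fact (Suc n) * x ^ Suc n) has_real_derivative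
        F (j + Suc n) 0 / fact (Suc n) * (real (Suc n) * s ^ n)) (at s within {0..x})"
      using DERIV_pow[of "Suc n"] by (intro DERIV_cmult) simp
    also have "F (j + Suc n) 0 / fact (Suc n) * (real (Suc n) * s ^ n)
        = F (Suc j + n) 0 / fact n * s ^ n"
      by (simp del: of_nat_Suc)
    finally show "((\<lambda>x. F (j + Suc n) 0 / fact (Suc n) * x ^ Suc n) has_real_derivative
        F (Suc j + n) 0 / fact n * s ^ n) (at s within {0..x})" .
    show "(F j has_real_derivative F (Suc j) s) (at s within {0..x})"
      using s Suc.prems by (auto intro: DERIV_subset[OF deriv])
    show "F (Suc j + n) 0 / fact n * s ^ n \<le> F (Suc j) s"
      using s Suc.prems by (intro Suc.IH) auto
  qed (use Suc.prems nonneg[of 0 j] in auto)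
  then show ?case .
qed

section \<open>Quasianalytic functions with nonnegative jet\<close>

definition log_convex_seq :: "(nat \<Rightarrow> real) \<Rightarrow> bool" where
  "log_convex_seq M \<longleftrightarrow> (\<forall>n. 0 < M n) \<and> (\<forall>n. (M (Suc n))\<^sup>2 \<le> M n * M (Suc (Suc n)))"

lemma log_convex_seq_pos: "log_convex_seq M \<Longrightarrow> 0 < M n"
  by (simp add: log_convex_seq_def)

lemma log_convex_seq_imp_incseq_ratio:
  assumes "log_convex_seq M"
  shows "incseq (\<lambda>n. M (Suc n) / M n)"
  using assms by (intro incseq_SucI) (simp add: log_convex_seq_def field_simps power2_eq_square)

lemma log_convex_seq_shift: "log_convex_seq M \<Longrightarrow> log_convex_seq (\<lambda>n. M (n + m))"
  by (simp add: log_convex_seq_def)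

lemma log_convex_seq_geometric_mult:
  assumes "log_convex_seq M" "0 < B" "0 < h"
  shows "log_convex_seq (\<lambda>n. B * h ^ n * M n)"
  unfolding log_convex_seq_def
proof (intro conjI allI)
  fix n
  show "0 < B * h ^ n * M n" using assms by (simp add: log_convex_seq_pos)
  have "(B * h ^ Suc n)\<^sup>2 * (M (Suc n))\<^sup>2 \<le> (B * h ^ Suc n)\<^sup>2 * (M n * M (Suc (Suc n)))"
    using assms(1) by (intro mult_left_mono) (auto simp: log_convex_seq_def)
  then show "(B * h ^ Suc n * M (Suc n))\<^sup>2
      \<le> B * h ^ n * M n * (B * h ^ Suc (Suc n) * M (Suc (Suc n)))"
    by (simp add: power2_eq_square mult_ac)
qed

lemma weight_sequence_imp_log_convex_seq:
  assumes "weight_sequence M"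
  shows "log_convex_seq M"
  unfolding log_convex_seq_def
proof (intro conjI allI)
  fix n
  show "0 < M n" using assms by (simp add: weight_sequence_def)
  have "\<forall>p\<ge>1. (M p)\<^sup>2 \<le> M (p - 1) * M (p + 1)"
    using assms unfolding weight_sequence_def by blast
  from this[rule_format, of "Suc n"] show "(M (Suc n))\<^sup>2 \<le> M n * M (Suc (Suc n))" by simp
qed

lemma quasianalytic_shift: "quasianalytic M \<Longrightarrow> quasianalytic (\<lambda>n. M (n + m))"
  using summable_iff_shift[of "\<lambda>n. M n / M (Suc n)" m] by (simp add: quasianalytic_def)

lemma quasianalytic_geometric_mult:
  assumes "quasianalytic M" "0 < B" "0 < h"
  shows "quasianalytic (\<lambda>n. B * h ^ n * M n)"
proof -
  have "(\<lambda>n. B * h ^ n * M n / (B * h ^ Suc n * M (Suc n))) = (\<lambda>n. 1 / h * (M n / M (Suc n)))"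
    using assms by (simp add: fun_eq_iff)
  then show ?thesis
    using assms summable_cmult_iff[of "1 / h" "\<lambda>n. M n / M (Suc n)"]
    by (simp add: quasianalytic_def)
qed

lemma not_summable_imp_tail_sum_unbounded:
  fixes u :: "nat \<Rightarrow> real"
  assumes "\<not> summable u" and nonneg: "\<And>n. 0 \<le> u n"
  shows "\<exists>K\<ge>N. C < sum u {N..<K}"
proof -
  have "\<not> summable (\<lambda>n. u (n + N))" using assms(1) by (simp add: summable_iff_shift)
  then have "\<not> (\<forall>n. (\<Sum>i\<le>n. u (i + N)) \<le> C)"
    using bounded_imp_summable[of "\<lambda>n. u (n + N)" C] nonneg by blast
  then obtain n where "C < (\<Sum>i\<le>n. u (i + N))" by (auto simp: not_le)
  also have "\<dots> = sum u {N..<Suc n + N}"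
    using sum.shift_bounds_nat_ivl[of u 0 N "Suc n"]
    by (simp add: atLeast0LessThan lessThan_Suc_atMost)
  finally show ?thesis by (intro exI[of _ "Suc n + N"]) simp
qed

locale log_convex_lower_bound =
  fixes F :: "nat \<Rightarrow> real \<Rightarrow> real" and M :: "nat \<Rightarrow> real" and T :: real
  assumes deriv: "x \<in> {0..T} \<Longrightarrow> (F j has_real_derivative F (Suc j) x) (at x within {0..T})"
    and lower_bound: "x \<in> {0..T} \<Longrightarrow> - M j \<le> F j x"
    and log_convex: "log_convex_seq M"
begin

lemma shift: "log_convex_lower_bound (\<lambda>n. F (n + m)) (\<lambda>n. M (n + m)) T"
  using deriv lower_bound log_convex by unfold_locales (auto intro: log_convex_seq_shift)

text \<open>One-sided version of Bang's norm \<open>sup\<^sub>j \<bar>F j x\<bar> / (e\<^sup>j M j)\<close> being at most \<open>b\<close>.\<close>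

definition bang_bound :: "real \<Rightarrow> real \<Rightarrow> bool" where
  "bang_bound b x \<longleftrightarrow> (\<forall>j. - (exp (real j) * M j * b) \<le> F j x)"

lemma bang_bound_mono:
  assumes "bang_bound b x" "b \<le> b'"
  shows "bang_bound b' x"
  unfolding bang_bound_def
proof
  fix j
  have "exp (real j) * M j * b \<le> exp (real j) * M j * b'"
    using assms(2) log_convex_seq_pos[OF log_convex, of j] by (intro mult_left_mono) auto
  then show "- (exp (real j) * M j * b') \<le> F j x"
    using assms(1) unfolding bang_bound_def by (meson le_imp_neg_le order_trans)
qed

lemma high_derivative_ge:
  assumes "x \<in> {0..T}" "n \<le> j" "exp (- real n) \<le> b"
  shows "- (exp (real j) * M j * b) \<le> F j x"
proof -
  have pos: "0 < M j" using log_convex by (rule log_convex_seq_pos)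
  have "exp (- real j) \<le> exp (- real n)" using assms(2) by simp
  also have "\<dots> \<le> b" by (rule assms(3))
  finally have "exp (real j) * M j * exp (- real j) \<le> exp (real j) * M j * b"
    using pos by (intro mult_left_mono) auto
  moreover have "exp (real j) * M j * exp (- real j) = M j" by (simp add: exp_minus)
  ultimately show ?thesis using lower_bound[OF assms(1), of j] by linarith
qed

lemma derivative_bound_descend:
  assumes "0 \<le> y" "y \<le> x" "x \<le> T" and "0 \<le> b"
    and ratio: "exp 1 * M (Suc j) \<le> c * M j"
    and start: "- (exp (real j) * M j * b) \<le> F j y"
    and next_order: "\<And>s. s \<in> {y..x} \<Longrightarrow>
      - (exp (real (Suc j)) * M (Suc j) * (b * exp (c * (s - y)))) \<le> F (Suc j) s"
  shows "- (exp (real j) * M j * (b * exp (c * (x - y)))) \<le> F j x"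
proof -
  have "- (exp (real j) * M j * b * exp (c * (x - y))) \<le> F j x"
  proof (rule neg_exp_le_of_derivative_ge[where f' = "F (Suc j)"])
    fix s assume s: "s \<in> {y..x}"
    show "(F j has_real_derivative F (Suc j) s) (at s within {y..x})"
      using s assms(1-3) by (intro DERIV_subset[OF deriv]) auto
    have "exp 1 * M (Suc j) * (exp (real j) * b * exp (c * (s - y)))
        \<le> c * M j * (exp (real j) * b * exp (c * (s - y)))"
      using ratio \<open>0 \<le> b\<close> by (intro mult_right_mono) auto
    then have "exp (real (Suc j)) * M (Suc j) * (b * exp (c * (s - y)))
        \<le> c * (exp (real j) * M j * b * exp (c * (s - y)))"
      by (simp add: exp_add mult_ac)
    then show "- (c * (exp (real j) * M j * b * exp (c * (s - y)))) \<le> F (Suc j) s"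
      using next_order[OF s] by linarith
  qed fact+
  then show ?thesis by (simp add: mult.assoc)
qed

text \<open>Orders above \<open>n\<close> satisfy the bound trivially; lower orders follow by integrating downwards.\<close>

lemma bang_bound_propagate:
  assumes y: "0 \<le> y" "bang_bound b y" and b: "exp (- real (Suc n)) \<le> b"
    and x: "y \<le> x" "x \<le> T"
  defines "c \<equiv> exp 1 * (M (Suc n) / M n)"
  shows "bang_bound (b * exp (c * (x - y))) x"
proof -
  have pos: "0 < M j" for j using log_convex by (rule log_convex_seq_pos)
  have b_pos: "0 < b" using b exp_gt_zero less_le_trans by blast
  have c_nonneg: "0 \<le> c" using pos[of n] pos[of "Suc n"] by (simp add: c_def)
  have "- (exp (real j) * M j * (b * exp (c * (x - y)))) \<le> F j x" for j
    using x
  proof (induction "Suc n - j" arbitrary: j x)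
    case 0
    have "b * 1 \<le> b * exp (c * (x - y))"
      using b_pos c_nonneg 0 by (intro mult_left_mono) auto
    with b have "exp (- real (Suc n)) \<le> b * exp (c * (x - y))" by linarith
    with 0 y(1) show ?case by (intro high_derivative_ge[of x "Suc n"]) auto
  next
    case (Suc m)
    have "M (Suc j) / M j \<le> M (Suc n) / M n"
      using incseqD[OF log_convex_seq_imp_incseq_ratio[OF log_convex]] Suc.hyps(2) by simp
    then have "exp 1 * M j * (M (Suc j) / M j) \<le> exp 1 * M j * (M (Suc n) / M n)"
      using pos[of j] by (intro mult_left_mono) auto
    then have ratio: "exp 1 * M (Suc j) \<le> c * M j"
      using pos[of j] by (simp add: c_def mult_ac)
    show ?case
    proof (rule derivative_bound_descend[OF y(1) Suc.prems _ ratio])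
      show "- (exp (real j) * M j * b) \<le> F j y" using y(2) by (simp add: bang_bound_def)
      show "- (exp (real (Suc j)) * M (Suc j) * (b * exp (c * (s - y)))) \<le> F (Suc j) s"
        if "s \<in> {y..x}" for s
        using Suc.hyps(2) that Suc.prems by (intro Suc.hyps(1)) auto
    qed (use b_pos in simp)
  qed
  then show ?thesis by (simp add: bang_bound_def)
qed

lemma bang_bound_climb:
  assumes "0 \<le> y" "bang_bound (exp (- real (Suc n))) y" "y \<le> x" "x \<le> T"
    and near: "x - y \<le> M n / M (Suc n) / exp 1"
  shows "bang_bound (exp (- real n)) x"
proof (rule bang_bound_mono)
  show "bang_bound (exp (- real (Suc n)) * exp (exp 1 * (M (Suc n) / M n) * (x - y))) x"
    using assms by (intro bang_bound_propagate) auto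
  have pos: "0 < M n" "0 < M (Suc n)" using log_convex by (simp_all add: log_convex_seq_pos)
  have "exp 1 * (M (Suc n) / M n) * (x - y)
      \<le> exp 1 * (M (Suc n) / M n) * (M n / M (Suc n) / exp 1)"
    using near pos by (intro mult_left_mono) auto
  also have "\<dots> = 1" using pos by simp
  finally show "exp (- real (Suc n)) * exp (exp 1 * (M (Suc n) / M n) * (x - y)) \<le> exp (- real n)"
    unfolding exp_add[symmetric] exp_le_cancel_iff by simp
qed

lemma bang_bound_of_le_sum:
  assumes nonneg_jet: "\<And>j. 0 \<le> F j 0"
    and "N \<le> K"
    and "x \<in> {0..T}" "x \<le> (\<Sum>n=N..<K. M n / M (Suc n)) / exp 1"
  shows "bang_bound (exp (- real N)) x"
  using \<open>N \<le> K\<close> assms(3,4)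
proof (induction N arbitrary: x rule: inc_induct)
  case base
  then have "x = 0" by simp
  moreover have "0 \<le> exp (real j) * M j * exp (- real K)" for j
    using log_convex_seq_pos[OF log_convex, of j] by simp
  ultimately show ?case
    using nonneg_jet unfolding bang_bound_def by (meson neg_le_0_iff_le order_trans)
next
  case (step n)
  define S where "S = (\<Sum>i=Suc n..<K. M i / M (Suc i)) / exp 1"
  have "0 \<le> S"
    unfolding S_def using log_convex_seq_pos[OF log_convex]
    by (intro divide_nonneg_nonneg sum_nonneg) (auto intro: less_imp_le)
  define y where "y = min x S"
  have y: "0 \<le> y" "y \<le> x" "y \<le> S" using \<open>0 \<le> S\<close> step.prems by (auto simp: y_def)
  have "(\<Sum>i=n..<K. M i / M (Suc i)) / exp 1 = M n / M (Suc n) / exp 1 + S"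
    unfolding S_def using step.hyps by (simp add: sum.atLeast_Suc_lessThan add_divide_distrib)
  moreover have "0 \<le> M n / M (Suc n) / exp 1"
    using log_convex_seq_pos[OF log_convex] by (simp add: less_imp_le)
  ultimately have "x - y \<le> M n / M (Suc n) / exp 1"
    using step.prems by (auto simp: y_def)
  moreover have "bang_bound (exp (- real (Suc n))) y"
    using y step.prems unfolding S_def by (intro step.IH) auto
  ultimately show ?case using y step.prems by (auto intro: bang_bound_climb[OF y(1)])
qed

theorem quasianalytic_nonneg_derivatives:
  assumes quasianalytic: "quasianalytic M"
    and nonneg_jet: "\<And>j. 0 \<le> F j 0"
    and x: "x \<in> {0..T}"
  shows "0 \<le> F j x"
proof -
  have bound: "- (exp (real j) * M j * exp (- real N)) \<le> F j x" for N
  proof -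
    have "0 \<le> M n / M (Suc n)" for n
      using log_convex_seq_pos[OF log_convex] by (simp add: less_imp_le)
    then obtain K where K: "N \<le> K" "x * exp 1 < (\<Sum>n=N..<K. M n / M (Suc n))"
      using quasianalytic not_summable_imp_tail_sum_unbounded unfolding quasianalytic_def by blast
    then have "x \<le> (\<Sum>n=N..<K. M n / M (Suc n)) / exp 1" by (simp add: field_simps)
    then have "bang_bound (exp (- real N)) x" by (rule bang_bound_of_le_sum[OF nonneg_jet K(1) x])
    then show ?thesis by (simp add: bang_bound_def)
  qed
  have "(\<lambda>N. - (exp (real j) * M j * exp (- real N))) \<longlonglongrightarrow> 0" by real_asymp
  then show ?thesis using bound by (intro LIMSEQ_le_const2) auto
qed

lemma quasianalytic_nonneg_jet_le:
  assumes "quasianalytic M" "\<And>j. 0 \<le> F j 0" "0 \<le> T"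
  shows "F n 0 / fact n * T ^ n \<le> F 0 T"
proof -
  have "0 \<le> F j x" if "x \<in> {0..T}" for j x
    using quasianalytic_nonneg_derivatives assms(1,2) that by blast
  then show ?thesis
    using taylor_term_le_of_nonneg_derivatives[of T F T 0 n] deriv assms(3) by simp
qed

lemma quasianalytic_eventually_nonneg_jet_le:
  assumes "quasianalytic M" and nonneg_jet: "\<And>j. m \<le> j \<Longrightarrow> 0 \<le> F j 0" and "0 \<le> T" "m \<le> j"
  shows "F j 0 / fact j * T ^ j \<le> F m T * T ^ m"
proof -
  interpret shifted: log_convex_lower_bound "\<lambda>n. F (n + m)" "\<lambda>n. M (n + m)" T by (rule shift)
  have "F j 0 / fact j * T ^ (j - m) \<le> F j 0 / fact (j - m) * T ^ (j - m)"
    using assms by (intro mult_right_mono divide_left_mono fact_mono) auto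
  also have "\<dots> \<le> F m T"
    using shifted.quasianalytic_nonneg_jet_le[of "j - m"] assms by (simp add: quasianalytic_shift)
  finally have "F j 0 / fact j * T ^ (j - m) * T ^ m \<le> F m T * T ^ m"
    using \<open>0 \<le> T\<close> by (intro mult_right_mono) auto
  then show ?thesis using \<open>m \<le> j\<close> by (simp add: mult.assoc flip: power_add)
qed

end

section \<open>Sequences and geometric growth\<close>

lemma bigo_sequence_imp_bound:
  fixes f g :: "nat \<Rightarrow> real"
  assumes "f \<in> O(g)" and pos: "\<And>k. 0 < g k"
  obtains C where "\<And>k. \<bar>f k\<bar> \<le> C * g k"
proof -
  obtain c where c_pos: "0 < c"
    and eventually_bound: "eventually (\<lambda>k. norm (f k) \<le> c * norm (g k)) sequentially"
    using assms(1) by (rule landau_o.bigE)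
  from eventually_bound have "eventually (\<lambda>k. norm (f k / g k) \<le> c) sequentially"
    by eventually_elim
      (use pos in \<open>simp add: norm_divide pos_divide_le_eq less_imp_neq[symmetric]\<close>)
  then have "Bseq (\<lambda>k. f k / g k)" using c_pos by (auto simp: Bfun_def)
  then obtain C where "\<And>k. norm (f k / g k) \<le> C" by (auto simp: Bseq_def)
  then have "\<bar>f k\<bar> / \<bar>g k\<bar> \<le> C" for k by (simp add: norm_divide)
  then have "\<bar>f k\<bar> \<le> C * g k" for k
    using pos[of k] by (metis abs_of_pos pos_divide_le_eq)
  then show thesis by (rule that)
qed

lemma geometric_bigo_mono:
  fixes q R :: real
  assumes "0 \<le> q" "q \<le> R"
  shows "(\<lambda>k::nat. q ^ k) \<in> O(\<lambda>k. R ^ k)"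
  using assms by (intro landau_o.big_mono always_eventually) (simp add: power_mono)

lemma not_bigo_geometric_of_root_unbounded:
  fixes f :: "nat \<Rightarrow> real"
  assumes pos: "\<And>k. 0 < f k"
    and unbounded: "\<And>C. \<exists>k>0. C < root k (f k)"
    and "0 < R"
  shows "f \<notin> O(\<lambda>k. R ^ k)"
proof
  assume "f \<in> O(\<lambda>k. R ^ k)"
  then obtain C where bound: "\<And>k. \<bar>f k\<bar> \<le> C * R ^ k"
    using bigo_sequence_imp_bound[of f "\<lambda>k. R ^ k"] \<open>0 < R\<close> by auto
  have "root k (f k) \<le> max 1 C * R" if "0 < k" for k
  proof -
    have "f k \<le> C * R ^ k" using bound[of k] by linarith
    also have "\<dots> \<le> max 1 C ^ k * R ^ k"
      using self_le_power[of "max 1 C" k] that \<open>0 < R\<close> by (intro mult_right_mono) auto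
    finally have "root k (f k) \<le> root k ((max 1 C * R) ^ k)"
      using that by (simp add: power_mult_distrib)
    also have "\<dots> = max 1 C * R" using that \<open>0 < R\<close> by (intro real_root_power_cancel) auto
    finally show ?thesis .
  qed
  then show False using unbounded[of "max 1 C * R"] by (meson not_less)
qed

lemma not_bigo_imp_exists_greater:
  fixes f g :: "nat \<Rightarrow> real"
  assumes "f \<notin> O(g)"
  shows "\<exists>k>m. c * norm (g k) < norm (f k)"
proof (rule ccontr)
  assume "\<not> ?thesis"
  then have "norm (f k) \<le> c * norm (g k)" if "m < k" for k using that by (meson not_less)
  then have "f \<in> O(g)" by (intro bigoI eventually_mono[OF eventually_gt_at_top[of m]])
  then show False using assms by blast
qed

lemma not_bigo_imp_strict_mono_selection:
  fixes f g :: "nat \<Rightarrow> nat \<Rightarrow> real"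
  assumes "\<And>j. f j \<notin> O(g j)"
  obtains \<kappa> :: "nat \<Rightarrow> nat" where
    "strict_mono \<kappa>" "\<And>j. c j * norm (g j (\<kappa> j)) < norm (f j (\<kappa> j))"
proof -
  have "\<exists>\<kappa>. \<forall>j. c j * norm (g j (\<kappa> j)) < norm (f j (\<kappa> j)) \<and> \<kappa> j < \<kappa> (Suc j)"
    by (rule dependent_nat_choice) (use not_bigo_imp_exists_greater[OF assms] in blast)+
  then show thesis using that by (auto simp: strict_mono_Suc_iff)
qed

lemma exists_sequence_between_bigo_families:
  fixes v g :: "nat \<Rightarrow> nat \<Rightarrow> real"
  assumes decseq: "\<And>k. decseq (\<lambda>j. v j k)" and incseq: "\<And>k. incseq (\<lambda>j. g j k)"
    and v_nonneg: "\<And>j k. 0 \<le> v j k" and g_nonneg: "\<And>j k. 0 \<le> g j k"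
    and not_bigo: "\<And>j. v j \<notin> O(g j)"
  obtains a where "\<And>k. 0 \<le> a k" "\<And>j. a \<in> O(v j)" "\<And>j. a \<notin> O(g j)"
proof -
  obtain \<kappa> where \<kappa>: "strict_mono \<kappa>"
    and large: "\<And>j. real j * norm (g j (\<kappa> j)) < norm (v j (\<kappa> j))"
    by (rule not_bigo_imp_strict_mono_selection[of v g real, OF not_bigo]) (rule that)
  define a where "a k = (if k \<in> range \<kappa> then v (inv \<kappa> k) k else 0)" for k
  have a_\<kappa>: "a (\<kappa> j) = v j (\<kappa> j)" for j
    using strict_mono_imp_inj_on[OF \<kappa>] by (simp add: a_def)
  show thesis
  proof
    show a_nonneg: "0 \<le> a k" for k using v_nonneg by (simp add: a_def)
    show "a \<in> O(v j)" for j
    proof (intro landau_o.big_mono eventually_mono[OF eventually_ge_at_top[of "\<kappa> j"]])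
      fix k assume "\<kappa> j \<le> k"
      then have "v i k \<le> v j k" if "k = \<kappa> i" for i
        using that decseqD[OF decseq] \<kappa> by (simp add: strict_mono_less_eq)
      then show "norm (a k) \<le> norm (v j k)" using v_nonneg a_\<kappa> by (auto simp: a_def)
    qed
    show "a \<notin> O(g i)" for i
    proof
      assume "a \<in> O(g i)"
      then obtain c m where bound: "\<And>k. m \<le> k \<Longrightarrow> norm (a k) \<le> c * norm (g i k)"
        unfolding bigo_def eventually_at_top_linorder by blast
      obtain n :: nat where "c \<le> real n" using real_arch_simple by blast
      define j where "j = max i (max m n)"
      have "i \<le> j" "c \<le> real j" using \<open>c \<le> real n\<close> by (auto simp: j_def)
      have "m \<le> \<kappa> j" using strict_mono_imp_increasing[OF \<kappa>, of j] by (simp add: j_def)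
      then have "a (\<kappa> j) \<le> c * g i (\<kappa> j)" using bound[of "\<kappa> j"] a_nonneg g_nonneg by simp
      also have "\<dots> \<le> real j * g j (\<kappa> j)"
        using \<open>c \<le> real j\<close> incseqD[OF incseq \<open>i \<le> j\<close>] g_nonneg by (intro mult_mono) auto
      finally show False using large[of j] v_nonneg g_nonneg by (simp add: a_\<kappa>)
    qed
  qed
qed

lemma exists_sequence_below_decseq_not_bigo_geometric:
  fixes v :: "nat \<Rightarrow> nat \<Rightarrow> real"
  assumes "\<And>k. decseq (\<lambda>j. v j k)" "\<And>j k. 0 \<le> v j k"
    and not_bigo: "\<And>j R. 0 < R \<Longrightarrow> v j \<notin> O(\<lambda>k. R ^ k)"
  obtains a where "\<And>k. 0 \<le> a k" "\<And>j. a \<in> O(v j)" "\<And>R. 0 < R \<Longrightarrow> a \<notin> O(\<lambda>k. R ^ k)"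
proof -
  have "v j \<notin> O(\<lambda>k. real (Suc j) ^ k)" for j by (rule not_bigo) simp
  moreover have "incseq (\<lambda>j. real (Suc j) ^ k)" for k by (intro incseq_SucI power_mono) auto
  ultimately obtain a where a: "\<And>k. 0 \<le> a k" "\<And>j. a \<in> O(v j)"
    and a_not_bigo: "\<And>j. a \<notin> O(\<lambda>k. real (Suc j) ^ k)"
    using exists_sequence_between_bigo_families[of v "\<lambda>j k. real (Suc j) ^ k"] assms(1,2)
    by (metis of_nat_0_le_iff zero_le_power)
  have "a \<notin> O(\<lambda>k. R ^ k)" if "0 < R" for R
  proof -
    obtain j :: nat where "R \<le> real j" using real_arch_simple by blast
    then have "(\<lambda>k. R ^ k) \<in> O(\<lambda>k. real (Suc j) ^ k)"
      using that by (intro geometric_bigo_mono) auto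
    then show ?thesis using a_not_bigo[of j] landau_o.big_trans by blast
  qed
  with a show thesis by (rule that)
qed

lemma geometric_mult_bigo_geometricD:
  fixes f :: "nat \<Rightarrow> real"
  assumes "(\<lambda>k. q ^ k * f k) \<in> O(\<lambda>k. R ^ k)" "q \<noteq> 0"
  shows "f \<in> O(\<lambda>k. (R / q) ^ k)"
proof -
  have "(\<lambda>k. (1 / q) ^ k * (q ^ k * f k)) \<in> O(\<lambda>k. (1 / q) ^ k * R ^ k)"
    using assms(1) by (rule landau_o.big.mult[OF landau_o.big_refl])
  then show ?thesis using assms(2) by (simp add: power_divide)
qed

lemma exists_sequence_small_not_bigo_geometric:
  fixes w :: "real \<Rightarrow> nat \<Rightarrow> real"
  assumes pos: "\<And>l k. 0 < l \<Longrightarrow> 0 < w l k"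
    and mono: "\<And>l l' k. 0 < l \<Longrightarrow> l \<le> l' \<Longrightarrow> w l k \<le> w l' k"
    and not_bigo: "\<And>l R. 0 < l \<Longrightarrow> 0 < R \<Longrightarrow> w l \<notin> O(\<lambda>k. R ^ k)"
  obtains a :: "nat \<Rightarrow> real" where
    "\<And>k. 0 \<le> a k"
    "\<And>l h. 0 < l \<Longrightarrow> 0 < h \<Longrightarrow> a \<in> O(\<lambda>k. h ^ k * w l k)"
    "\<And>R. 0 < R \<Longrightarrow> a \<notin> O(\<lambda>k. R ^ k)"
proof -
  define e where "e j = 1 / real (Suc j)" for j
  have e_pos: "0 < e j" for j by (simp add: e_def)
  define v where "v j k = e j ^ k * w (e j) k" for j k
  have v_pos: "0 < v j k" for j k using e_pos pos by (simp add: v_def)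
  have v_le: "v j k \<le> h ^ k * w l k" if "e j \<le> h" "e j \<le> l" for j k h l
    unfolding v_def using that e_pos[of j] pos[of "e j"]
    by (intro mult_mono power_mono mono) (auto intro: less_imp_le)
  have "e j \<le> e i" if "i \<le> j" for i j using that by (simp add: e_def frac_le)
  then have v_decseq: "decseq (\<lambda>j. v j k)" for k
    unfolding decseq_def by (subst (2) v_def) (auto intro: v_le)
  have v_not_bigo: "v j \<notin> O(\<lambda>k. R ^ k)" if "0 < R" for j R
    using geometric_mult_bigo_geometricD[of "e j" "w (e j)" R] e_pos[of j] that
      not_bigo[OF e_pos, of "R / e j"] by (auto simp: v_def[abs_def])
  obtain a where a: "\<And>k. 0 \<le> a k" "\<And>j. a \<in> O(v j)" "\<And>R. 0 < R \<Longrightarrow> a \<notin> O(\<lambda>k. R ^ k)"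
    using exists_sequence_below_decseq_not_bigo_geometric[OF v_decseq less_imp_le[OF v_pos] v_not_bigo]
    by metis
  have "a \<in> O(\<lambda>k. h ^ k * w l k)" if l: "0 < l" and h: "0 < h" for l h
  proof -
    obtain j where "e j < min l h"
      unfolding e_def by (rule nat_approx_posE[of "min l h"]) (use l h in auto)
    then have "v j k \<le> h ^ k * w l k" for k by (intro v_le) auto
    then have "v j \<in> O(\<lambda>k. h ^ k * w l k)"
      using v_pos[of j] h pos[OF l]
      by (intro landau_o.big_mono always_eventually) (simp add: less_imp_le)
    then show ?thesis by (rule landau_o.big_trans[OF a(2)])
  qed
  with a(1) show thesis using a(3) by (rule that)
qed

section \<open>Polynomial multiples of sequences\<close>

lemma poly_bigo_exponential: "(\<lambda>k. poly p (real k)) \<in> O(\<lambda>k. 2 ^ k)" for p :: "real poly"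
proof -
  have "(\<lambda>k. coeff p i * real k ^ i) \<in> O(\<lambda>k. 2 ^ k)" for i
  proof (cases "coeff p i = 0")
    case False
    have "(\<lambda>k. real k ^ i) \<in> O(\<lambda>k. 2 ^ k)" by real_asymp
    then show ?thesis using False by simp
  qed simp
  then show ?thesis unfolding poly_altdef by (rule big_sum_in_bigo)
qed

lemma poly_eventually_ge_lead_coeff:
  fixes p :: "real poly"
  assumes "0 < lead_coeff p"
  shows "eventually (\<lambda>k::nat. lead_coeff p \<le> poly p (real k)) sequentially"
proof -
  have "eventually (\<lambda>x. lead_coeff p \<le> poly p x) at_top"
    using poly_pinfty_gt_lc[OF assms] by (auto simp: eventually_at_top_linorder)
  then show ?thesis using filterlim_real_sequentially by (rule eventually_compose_filterlim)
qed

lemma poly_eventually_abs_ge_lead_coeff: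
  fixes p :: "real poly"
  assumes "p \<noteq> 0"
  shows "eventually (\<lambda>k::nat. \<bar>lead_coeff p\<bar> \<le> \<bar>poly p (real k)\<bar>) sequentially"
proof (cases "0 < lead_coeff p")
  case True
  show ?thesis using poly_eventually_ge_lead_coeff[OF True] by eventually_elim (use True in auto)
next
  case False
  then have "0 < lead_coeff (- p)" using assms by (simp add: lead_coeff_minus less_le)
  from poly_eventually_ge_lead_coeff[OF this] show ?thesis
    by eventually_elim (use False in \<open>auto simp: lead_coeff_minus\<close>)
qed

lemma bigo_poly_mult:
  fixes p :: "real poly" and a :: "nat \<Rightarrow> real"
  assumes "p \<noteq> 0"
  shows "a \<in> O(\<lambda>k. poly p (real k) * a k)"
proof (rule landau_o.big_mult_1'[OF _ landau_o.big_refl])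
  show "(\<lambda>_. 1) \<in> O(\<lambda>k. poly p (real k))"
  proof (rule bigoI)
    show "eventually (\<lambda>k. norm (1 :: real) \<le> 1 / \<bar>lead_coeff p\<bar> * norm (poly p (real k))) at_top"
      using poly_eventually_abs_ge_lead_coeff[OF assms]
      by eventually_elim (use assms in \<open>simp add: field_simps\<close>)
  qed
qed

lemma poly_mult_bigo_geometric_weight:
  fixes a w :: "nat \<Rightarrow> real" and p :: "real poly"
  assumes "a \<in> O(\<lambda>k. (h / 2) ^ k * w k)"
  shows "(\<lambda>k. poly p (real k) * a k) \<in> O(\<lambda>k. h ^ k * w k)"
proof -
  have "(\<lambda>k. poly p (real k) * a k) \<in> O(\<lambda>k. 2 ^ k * ((h / 2) ^ k * w k))"
    using poly_bigo_exponential assms by (rule landau_o.big.mult)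
  then show ?thesis by (simp add: power_divide)
qed

section \<open>Jets along a coordinate axis\<close>

definition axis_multi_index :: "'n \<Rightarrow> nat \<Rightarrow> 'n \<Rightarrow> nat" where
  "axis_multi_index i k = (\<lambda>_. 0)(i := k)"

lemma mlen_axis_multi_index [simp]: "mlen (axis_multi_index i k :: 'n::finite \<Rightarrow> nat) = k"
  by (simp add: mlen_def axis_multi_index_def fun_upd_def)

definition axis_jet :: "'n \<Rightarrow> (nat \<Rightarrow> real) \<Rightarrow> ('n \<Rightarrow> nat) \<Rightarrow> real" where
  "axis_jet i s \<alpha> = (if \<alpha> = axis_multi_index i (\<alpha> i) then s (\<alpha> i) else 0)"

lemma axis_jet_axis_multi_index [simp]: "axis_jet i s (axis_multi_index i k) = s k"
  by (simp add: axis_jet_def axis_multi_index_def)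

lemma axis_jet_in_Lambda_beurling:
  fixes i :: "'n::finite"
  assumes pos: "\<And>l k. 0 < l \<Longrightarrow> 0 < NN l k"
    and small: "\<And>l h. 0 < l \<Longrightarrow> 0 < h \<Longrightarrow> s \<in> O(\<lambda>k. h ^ k * (NN l k / fact k))"
  shows "axis_jet i s \<in> Lambda_beurling NN"
  unfolding Lambda_beurling_def seq_norm_finite_def
proof (intro CollectI allI impI)
  fix l h :: real assume l: "0 < l" and h: "0 < h"
  have weight_pos: "0 < h ^ k * (NN l k / fact k)" for k using h pos[OF l] by simp
  obtain C where bound: "\<And>k. \<bar>s k\<bar> \<le> C * (h ^ k * (NN l k / fact k))"
    using bigo_sequence_imp_bound[OF small[OF l h] weight_pos] by blast
  have "\<bar>axis_jet i s \<alpha>\<bar> \<le> C * (h ^ mlen \<alpha> * (NN l (mlen \<alpha>) / fact (mlen \<alpha>)))" for \<alpha>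
  proof (cases "\<alpha> = axis_multi_index i (\<alpha> i)")
    case True
    then have "mlen \<alpha> = \<alpha> i" by (metis mlen_axis_multi_index)
    then show ?thesis using bound[of "\<alpha> i"] True by (simp add: axis_jet_def)
  next
    case False
    have "0 \<le> C * (h ^ mlen \<alpha> * (NN l (mlen \<alpha>) / fact (mlen \<alpha>)))"
      using bound[of "mlen \<alpha>"] abs_ge_zero order_trans by blast
    then show ?thesis using False by (simp add: axis_jet_def)
  qed
  then show "\<exists>C. \<forall>\<alpha>. \<bar>axis_jet i s \<alpha>\<bar> \<le> C * h ^ mlen \<alpha> * (NN l (mlen \<alpha>) / fact (mlen \<alpha>))"
    by (auto simp: mult.assoc)
qed

lemma smooth_family_has_derivative_along_axis:
  assumes "smooth_family U D" "x + t *\<^sub>R axis i 1 \<in> U"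
  shows "((\<lambda>s. D \<alpha> (x + s *\<^sub>R axis i 1)) has_real_derivative
    D (\<alpha>(i := Suc (\<alpha> i))) (x + t *\<^sub>R axis i 1)) (at t)"
proof -
  have "((\<lambda>s. D \<alpha> (x + t *\<^sub>R axis i 1 + s *\<^sub>R axis i 1)) has_real_derivative
      D (\<alpha>(i := Suc (\<alpha> i))) (x + t *\<^sub>R axis i 1)) (at 0)"
    using assms unfolding smooth_family_def by blast
  then have "((\<lambda>s. D \<alpha> (x + (s + t) *\<^sub>R axis i 1)) has_real_derivative
      D (\<alpha>(i := Suc (\<alpha> i))) (x + t *\<^sub>R axis i 1)) (at 0)"
    by (simp add: scaleR_add_left add_ac)
  then show ?thesis using DERIV_shift[of "\<lambda>s. D \<alpha> (x + s *\<^sub>R axis i 1)" _ 0 t] by simp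
qed

lemma smooth_family_axis_log_convex_lower_bound:
  assumes "smooth_family U D" and "log_convex_seq M"
    and on_axis: "\<And>t. t \<in> {0..T} \<Longrightarrow> t *\<^sub>R axis i 1 \<in> U"
    and bound: "\<And>k t. t \<in> {0..T} \<Longrightarrow> \<bar>D (axis_multi_index i k) (t *\<^sub>R axis i 1)\<bar> \<le> M k"
  shows "log_convex_lower_bound (\<lambda>k t. D (axis_multi_index i k) (t *\<^sub>R axis i 1)) M T"
proof
  fix k t assume t: "t \<in> {0..T}"
  have "(axis_multi_index i k)(i := Suc (axis_multi_index i k i)) = axis_multi_index i (Suc k)"
    by (simp add: axis_multi_index_def)
  then show "((\<lambda>t. D (axis_multi_index i k) (t *\<^sub>R axis i 1)) has_real_derivative
      D (axis_multi_index i (Suc k)) (t *\<^sub>R axis i 1)) (at t within {0..T})"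
    using smooth_family_has_derivative_along_axis[OF assms(1), of 0 t i "axis_multi_index i k"]
      on_axis[OF t]
    by (auto intro: has_field_derivative_at_within)
  show "- M k \<le> D (axis_multi_index i k) (t *\<^sub>R axis i 1)"
    using bound[OF t, of k] by (simp add: abs_le_iff)
qed fact

lemma norm_finite_imp_pos_bound:
  assumes "norm_finite M K h D" and pos: "0 < h" "\<And>p. 0 < M p"
  obtains B where "0 < B" "\<And>\<alpha> x. x \<in> K \<Longrightarrow> \<bar>D \<alpha> x\<bar> \<le> B * h ^ mlen \<alpha> * M (mlen \<alpha>)"
proof -
  obtain C where bound: "\<And>\<alpha> x. x \<in> K \<Longrightarrow> \<bar>D \<alpha> x\<bar> \<le> C * h ^ mlen \<alpha> * M (mlen \<alpha>)"
    using assms(1) unfolding norm_finite_def by blast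
  have "C * h ^ p * M p \<le> max 1 C * h ^ p * M p" for p
    using pos(1) pos(2)[of p] by (intro mult_right_mono) auto
  then show thesis using bound by (intro that[of "max 1 C"]) (auto intro: order_trans)
qed

lemma jet_roumieu_axis_restriction:
  fixes b :: "('n::finite \<Rightarrow> nat) \<Rightarrow> real"
  assumes MM: "weight_matrix MM" "quasianalytic_matrix MM" and "b \<in> jet_roumieu MM"
  obtains F M T where "0 < T" "log_convex_lower_bound F M T" "quasianalytic M"
    "\<And>k. F k 0 / fact k = b (axis_multi_index i k)"
proof -
  obtain U D where U: "open U" "(0::real^'n) \<in> U" and D: "E_roumieu_family MM U D"
    and b_eq: "b = (\<lambda>\<alpha>. D \<alpha> 0 / fact (mlen \<alpha>))"
    using \<open>b \<in> jet_roumieu MM\<close> unfolding jet_roumieu_def by blast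
  obtain T where T: "0 < T" "cball 0 T \<subseteq> U" using open_contains_cball U by blast
  obtain l h where l: "0 < l" and h: "0 < h" and bound: "norm_finite (MM l) (cball 0 T) h D"
    using D T(2) unfolding E_roumieu_family_def by (meson compact_cball)
  have weight: "log_convex_seq (MM l)" "quasianalytic (MM l)"
    using MM l by (auto simp: weight_matrix_def quasianalytic_matrix_def
        intro: weight_sequence_imp_log_convex_seq)
  obtain B where B: "0 < B"
    "\<And>\<alpha> x. x \<in> cball 0 T \<Longrightarrow> \<bar>D \<alpha> x\<bar> \<le> B * h ^ mlen \<alpha> * MM l (mlen \<alpha>)"
    using norm_finite_imp_pos_bound[OF bound h log_convex_seq_pos[OF weight(1)]] by blast
  define F where "F k t = D (axis_multi_index i k) (t *\<^sub>R axis i 1)" for k t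
  have on_axis: "t *\<^sub>R axis i (1::real) \<in> cball 0 T" if "t \<in> {0..T}" for t
    using that by simp
  have "log_convex_lower_bound F (\<lambda>k. B * h ^ k * MM l k) T"
    unfolding F_def
  proof (rule smooth_family_axis_log_convex_lower_bound)
    show "smooth_family U D" using D by (simp add: E_roumieu_family_def)
    show "log_convex_seq (\<lambda>k. B * h ^ k * MM l k)"
      using weight(1) B(1) h by (rule log_convex_seq_geometric_mult)
    fix t assume t: "t \<in> {0..T}"
    show "t *\<^sub>R axis i 1 \<in> U" using on_axis[OF t] T(2) by blast
    show "\<bar>D (axis_multi_index i k) (t *\<^sub>R axis i 1)\<bar> \<le> B * h ^ k * MM l k" for k
      using B(2)[OF on_axis[OF t], of "axis_multi_index i k"] by simp
  qed
  moreover have "quasianalytic (\<lambda>k. B * h ^ k * MM l k)"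
    using weight(2) B(1) h by (rule quasianalytic_geometric_mult)
  moreover have "F k 0 / fact k = b (axis_multi_index i k)" for k by (simp add: F_def b_eq)
  ultimately show thesis by (rule that[OF T(1)])
qed

lemma jet_roumieu_nonneg_axis_bigo_geometric:
  fixes b :: "('n::finite \<Rightarrow> nat) \<Rightarrow> real"
  assumes "weight_matrix MM" "quasianalytic_matrix MM" "b \<in> jet_roumieu MM"
    and "eventually (\<lambda>k. 0 \<le> b (axis_multi_index i k)) sequentially"
  obtains R where "0 < R" "(\<lambda>k. b (axis_multi_index i k)) \<in> O(\<lambda>k. R ^ k)"
proof -
  obtain F M T where T: "0 < T" and tower: "log_convex_lower_bound F M T"
    and quasianalytic: "quasianalytic M" and jet: "\<And>k. F k 0 / fact k = b (axis_multi_index i k)"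
    by (rule jet_roumieu_axis_restriction[OF assms(1-3), of i]) (rule that)
  interpret log_convex_lower_bound F M T by (rule tower)
  obtain m where nonneg: "\<And>k. m \<le> k \<Longrightarrow> 0 \<le> b (axis_multi_index i k)"
    using assms(4) by (auto simp: eventually_sequentially)
  have "0 \<le> F k 0" if "m \<le> k" for k
    using nonneg[OF that] jet[of k] by (metis fact_gt_zero mult_zero_left pos_le_divide_eq)
  then have "b (axis_multi_index i k) * T ^ k \<le> F m T * T ^ m" if "m \<le> k" for k
    using quasianalytic_eventually_nonneg_jet_le[OF quasianalytic, of m k] that T by (simp add: jet)
  then have "norm (b (axis_multi_index i k)) \<le> F m T * T ^ m * norm ((1 / T) ^ k)"
    if "m \<le> k" for k
    using that nonneg[of k] T by (simp add: power_divide pos_le_divide_eq)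
  then have "(\<lambda>k. b (axis_multi_index i k)) \<in> O(\<lambda>k. (1 / T) ^ k)"
    by (intro bigoI eventually_mono[OF eventually_ge_at_top[of m]])
  then show thesis using T by (intro that[of "1 / T"]) auto
qed

lemma zero_in_jet_roumieu: "(\<lambda>_. 0) \<in> (jet_roumieu MM :: (('n::finite \<Rightarrow> nat) \<Rightarrow> real) set)"
proof -
  have "norm_finite M K h (\<lambda>_ _. 0)" for M h and K :: "(real ^ 'n) set"
    by (auto simp: norm_finite_def intro: exI[of _ 0])
  then have "E_roumieu_family MM (UNIV :: (real ^ 'n) set) (\<lambda>_ _. 0)"
    by (auto simp: E_roumieu_family_def smooth_family_def intro: zero_less_one)
  then show ?thesis unfolding jet_roumieu_def by force
qed

lemma jet_roumieu_scale:
  fixes b :: "('n::finite \<Rightarrow> nat) \<Rightarrow> real"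
  assumes "b \<in> jet_roumieu MM"
  shows "(\<lambda>\<alpha>. c * b \<alpha>) \<in> jet_roumieu MM"
proof -
  obtain U D where U: "open U" "(0::real^'n) \<in> U" and D: "E_roumieu_family MM U D"
    and b_eq: "b = (\<lambda>\<alpha>. D \<alpha> 0 / fact (mlen \<alpha>))"
    using assms unfolding jet_roumieu_def by blast
  have "smooth_family U (\<lambda>\<alpha> x. c * D \<alpha> x)"
    using D unfolding E_roumieu_family_def smooth_family_def
    by (auto intro!: continuous_on_mult_left DERIV_cmult)
  moreover have "norm_finite M K h (\<lambda>\<alpha> x. c * D \<alpha> x)" if bound: "norm_finite M K h D" for M K h
  proof -
    obtain C where "\<And>\<alpha> x. x \<in> K \<Longrightarrow> \<bar>D \<alpha> x\<bar> \<le> C * h ^ mlen \<alpha> * M (mlen \<alpha>)"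
      using bound unfolding norm_finite_def by blast
    then have "\<bar>c * D \<alpha> x\<bar> \<le> \<bar>c\<bar> * C * h ^ mlen \<alpha> * M (mlen \<alpha>)" if "x \<in> K" for \<alpha> x
      using mult_left_mono[of "\<bar>D \<alpha> x\<bar>" _ "\<bar>c\<bar>"] that by (simp add: abs_mult mult.assoc)
    then show ?thesis unfolding norm_finite_def by blast
  qed
  ultimately have "E_roumieu_family MM U (\<lambda>\<alpha> x. c * D \<alpha> x)"
    using D unfolding E_roumieu_family_def by meson
  then show ?thesis unfolding jet_roumieu_def b_eq using U by force
qed

lemma axis_jet_poly_mult_notin_jet_roumieu:
  fixes i :: "'n::finite" and p :: "real poly"
  assumes MM: "weight_matrix MM" "quasianalytic_matrix MM"
    and nonneg: "\<And>k. 0 \<le> a k" and large: "\<And>R. 0 < R \<Longrightarrow> a \<notin> O(\<lambda>k. R ^ k)"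
    and "p \<noteq> 0"
  shows "axis_jet i (\<lambda>k. poly p (real k) * a k) \<notin> jet_roumieu MM"
proof
  assume jet: "axis_jet i (\<lambda>k. poly p (real k) * a k) \<in> jet_roumieu MM"
  define c where "c = sgn (lead_coeff p)"
  have c_nonzero: "c \<noteq> 0" and lead_coeff_pos: "0 < lead_coeff (smult c p)"
    using \<open>p \<noteq> 0\<close> by (auto simp: c_def sgn_if not_less less_le)
  have "eventually (\<lambda>k. 0 \<le> c * axis_jet i (\<lambda>k. poly p (real k) * a k) (axis_multi_index i k))
      sequentially"
    using poly_eventually_ge_lead_coeff[OF lead_coeff_pos]
    by eventually_elim (use lead_coeff_pos nonneg in \<open>auto simp flip: mult.assoc\<close>)
  then obtain R where "0 < R"
    "(\<lambda>k. c * axis_jet i (\<lambda>k. poly p (real k) * a k) (axis_multi_index i k)) \<in> O(\<lambda>k. R ^ k)"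
    using jet_roumieu_nonneg_axis_bigo_geometric[OF MM jet_roumieu_scale[OF jet]] by blast
  then have "(\<lambda>k. poly p (real k) * a k) \<in> O(\<lambda>k. R ^ k)" using c_nonzero by simp
  then have "a \<in> O(\<lambda>k. R ^ k)" by (rule landau_o.big_trans[OF bigo_poly_mult[OF \<open>p \<noteq> 0\<close>]])
  then show False using large \<open>0 < R\<close> by blast
qed

section \<open>Lineability\<close>

lemma lineable_mono: "lineable L \<Longrightarrow> L \<subseteq> L' \<Longrightarrow> lineable L'"
  unfolding lineable_def by blast

lemma lineableI_linear_poly:
  fixes \<phi> :: "real poly \<Rightarrow> 'a \<Rightarrow> real"
  assumes add: "\<And>p q x. \<phi> (p + q) x = \<phi> p x + \<phi> q x"
    and smult: "\<And>c p x. \<phi> (smult c p) x = c * \<phi> p x"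
    and in_L: "\<And>p. p \<noteq> 0 \<Longrightarrow> \<phi> p \<in> L" and zero_notin: "(\<lambda>_. 0) \<notin> L"
  shows "lineable L"
proof -
  have zero: "\<phi> 0 = (\<lambda>_. 0)" using smult[of 0 0] by auto
  have nonzero: "\<phi> p \<noteq> (\<lambda>_. 0)" if "p \<noteq> 0" for p using in_L[OF that] zero_notin by metis
  have "fun_subspace (range \<phi>)"
    unfolding fun_subspace_def by (auto simp flip: add smult zero)
  moreover have "range \<phi> \<subseteq> L \<union> {\<lambda>_. 0}" using in_L zero by (metis UnCI image_subsetI insertI1)
  moreover have "lin_indep_seq (\<lambda>n. \<phi> (monom 1 n))"
    unfolding lin_indep_seq_def
  proof (intro allI impI)
    fix n j :: nat and c :: "nat \<Rightarrow> real"
    assume vanishing: "(\<lambda>x. \<Sum>i<n. c i * \<phi> (monom 1 i) x) = (\<lambda>_. 0)" and j: "j < n"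
    have "\<phi> (\<Sum>i<m. monom (c i) i) x = (\<Sum>i<m. c i * \<phi> (monom 1 i) x)" for m x
    proof (induction m)
      case (Suc m)
      have "\<phi> (monom (c m) m) x = c m * \<phi> (monom 1 m) x"
        using smult[of "c m" "monom 1 m" x] by (simp add: smult_monom)
      then show ?case using Suc by (simp add: add)
    qed (simp add: zero)
    then have "\<phi> (\<Sum>i<n. monom (c i) i) = (\<lambda>_. 0)" using vanishing by presburger
    then have "(\<Sum>i<n. monom (c i) i) = 0" using nonzero by blast
    then have "coeff (\<Sum>i<n. monom (c i) i) j = 0" by simp
    then show "c j = 0" using j by (simp add: coeff_sum)
  qed
  moreover have "\<forall>n. \<phi> (monom 1 n) \<in> range \<phi>" by simp
  ultimately show ?thesis unfolding lineable_def by metis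
qed

lemma jet_beurling_subset_jet_roumieu: "jet_beurling MM \<subseteq> jet_roumieu MM"
proof -
  have "E_beurling_family MM U D \<Longrightarrow> E_roumieu_family MM U D" for U and D :: "('a \<Rightarrow> nat) \<Rightarrow> _"
    unfolding E_beurling_family_def E_roumieu_family_def by (meson zero_less_one)
  then show ?thesis unfolding jet_beurling_def jet_roumieu_def by blast
qed

lemma Lambda_beurling_subset_Lambda_roumieu: "Lambda_beurling NN \<subseteq> Lambda_roumieu NN"
  unfolding Lambda_beurling_def Lambda_roumieu_def by (auto intro!: exI[of _ 1])

theorem lineable_Lambda_beurling_diff_jet_roumieu:
  assumes MM: "weight_matrix MM" "quasianalytic_matrix MM" and NN: "weight_matrix NN"
    and unbounded: "\<And>l C. 0 < l \<Longrightarrow> \<exists>k>0. C < root k (NN l k / fact k)"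
  shows "lineable (Lambda_beurling NN - (jet_roumieu MM :: (('n::finite \<Rightarrow> nat) \<Rightarrow> real) set))"
proof -
  have pos: "0 < NN l k" if "0 < l" for l k
    using NN that by (auto simp: weight_matrix_def weight_sequence_def)
  obtain a :: "nat \<Rightarrow> real" where nonneg: "\<And>k. 0 \<le> a k"
    and small: "\<And>l h. 0 < l \<Longrightarrow> 0 < h \<Longrightarrow> a \<in> O(\<lambda>k. h ^ k * (NN l k / fact k))"
    and large: "\<And>R. 0 < R \<Longrightarrow> a \<notin> O(\<lambda>k. R ^ k)"
  proof (rule exists_sequence_small_not_bigo_geometric[of "\<lambda>l k. NN l k / fact k"])
    show "NN l k / fact k \<le> NN l' k / fact k" if "0 < l" "l \<le> l'" for l l' k
      using NN that by (auto simp: weight_matrix_def intro!: divide_right_mono)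
    show "(\<lambda>k. NN l k / fact k) \<notin> O(\<lambda>k. R ^ k)" if "0 < l" "0 < R" for l R
      using that pos unbounded by (intro not_bigo_geometric_of_root_unbounded) auto
  qed (use pos in auto)
  define i :: 'n where "i = undefined"
  show ?thesis
  proof (rule lineableI_linear_poly[where \<phi> = "\<lambda>p. axis_jet i (\<lambda>k. poly p (real k) * a k)"])
    fix p :: "real poly" assume "p \<noteq> 0"
    have "axis_jet i (\<lambda>k. poly p (real k) * a k) \<in> Lambda_beurling NN"
      using pos small by (intro axis_jet_in_Lambda_beurling poly_mult_bigo_geometric_weight) auto
    moreover have "axis_jet i (\<lambda>k. poly p (real k) * a k) \<notin> jet_roumieu MM"
      by (rule axis_jet_poly_mult_notin_jet_roumieu[OF MM nonneg large \<open>p \<noteq> 0\<close>])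
    ultimately show "axis_jet i (\<lambda>k. poly p (real k) * a k) \<in> Lambda_beurling NN - jet_roumieu MM"
      by blast
  qed (auto simp: axis_jet_def algebra_simps zero_in_jet_roumieu)
qed

theorem mainTheorem14:
  fixes MM NN :: "real \<Rightarrow> nat \<Rightarrow> real"
  assumes "weight_matrix MM" and "quasianalytic_matrix MM"
    and "weight_matrix NN" and "quasianalytic_matrix NN"
  shows
    "((\<forall>l>0. \<forall>C::real. \<exists>k>0. root k (NN l k / fact k) > C) \<longrightarrow>
        lineable (Lambda_roumieu NN - (jet_roumieu MM :: (('n::finite \<Rightarrow> nat) \<Rightarrow> real) set)) \<and>
        lineable (Lambda_roumieu NN - (jet_beurling MM :: (('n \<Rightarrow> nat) \<Rightarrow> real) set)))
     \<and>
     ((\<forall>l>0. filterlim (\<lambda>k. root k (NN l k / fact k)) at_top at_top) \<longrightarrow>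
        lineable (Lambda_beurling NN - (jet_roumieu MM :: (('n \<Rightarrow> nat) \<Rightarrow> real) set)) \<and>
        lineable (Lambda_beurling NN - (jet_beurling MM :: (('n \<Rightarrow> nat) \<Rightarrow> real) set)))"
    (is "(?unbounded \<longrightarrow> _) \<and> (?divergent \<longrightarrow> _)")
proof -
  have lineable_superset: "lineable L"
    if ?unbounded and "Lambda_beurling NN - (jet_roumieu MM :: (('n \<Rightarrow> nat) \<Rightarrow> real) set) \<subseteq> L" for L
    using lineable_Lambda_beurling_diff_jet_roumieu[OF assms(1-3)] that
    by (auto intro: lineable_mono)
  have ?unbounded if ?divergent
  proof (intro allI impI)
    fix l C :: real assume "0 < l"
    with that have "eventually (\<lambda>k. C < root k (NN l k / fact k)) at_top"
      by (simp add: filterlim_at_top_dense)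
    then have "eventually (\<lambda>k. 0 < k \<and> C < root k (NN l k / fact k)) at_top"
      using eventually_gt_at_top[of 0] by eventually_elim simp
    then show "\<exists>k>0. C < root k (NN l k / fact k)"
      by (rule eventually_happens'[OF sequentially_bot])
  qed
  then show ?thesis
    using jet_beurling_subset_jet_roumieu Lambda_beurling_subset_Lambda_roumieu
    by (intro conjI impI lineable_superset) blast+
qed

end
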